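(* Let $n\ge 2$ be an integer and let $L_p$ be the Laguerre iteration function of the polynomial $p_n(z)=z^n-1$. For every $z\in\mathbb{C}\setminus\{0\}$ whose argument is not equal (modulo $2\pi$) to any of the angles $\frac{(2k+1)\pi}{n}$, $k=0,\dots,n-1$, one has $L_p(\bar z)=\overline{L_p(z)}$; that is, $L_p$ commutes with complex conjugation at such points.
   Context: $\sqrt{w}$ denotes the principal square root: if $w=\rho e^{i\phi}$ with $\rho>0$ and $-\pi<\phi\le\pi$, then $\sqrt{w}=\sqrt{\rho}\,e^{i\phi/2}$. For an integer $n\ge2$, the Laguerre iteration function of $p_n(z)=z^n-1$ is $$L_p(z)=z\,\frac{\frac{1}{\sqrt{z^n}}+(n-1)}{\sqrt{z^n}+(n-1)},\qquad z\in\mathbb{C}\setminus\{0\}.$$ *)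

theory Defs
  imports "HOL-Analysis.Complex_Transcendental" "HOL-Library.Real_Mod"
begin

lemma csqrt_eq_polar: "csqrt w = complex_of_real (sqrt (cmod w)) * cis (Arg w / 2)"
  by (metis Arg_csqrt norm_csqrt rcis_cmod_Arg rcis_def)

(* The denominator is nonzero for n >= 2, since Re (csqrt w) >= 0.  At z = 0, which is outside
   the mathematical domain, the value is an artefact of totality. *)
definition laguerre_iter :: "nat \<Rightarrow> complex \<Rightarrow> complex" where
  "laguerre_iter n z =
     z * ((1 / csqrt (z ^ n) + (of_nat n - 1)) / (csqrt (z ^ n) + (of_nat n - 1)))"

end

theory Submission
  imports Defs
begin

text \<open>
  Conjugation is a field automorphism, so it passes through every operation in the Laguerre
  iteration function except possibly the principal square root of \<open>z ^ n\<close>. The principal square root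
  commutes with conjugation off its branch cut, the nonpositive real axis. At a negative real \<open>w\<close>,
  however, \<open>cnj w = w\<close> has the same, nonreal root as \<open>w\<close>, and the identity breaks down. For nonzero \<open>z\<close>, the excluded
  angles are exactly those for which \<open>z ^ n\<close> lies on the cut
  (\<open>Arg_rcong_odd_pi_over_n_if_power_nonpos\<close> is the implication that matters), so off these angles
  the identity holds (\<open>laguerre_iter_cnj\<close>).
\<close>

lemma laguerre_iter_cnj:
  assumes "z ^ n \<notin> \<real>\<^sub>\<le>\<^sub>0"
  shows "laguerre_iter n (cnj z) = cnj (laguerre_iter n z)"
  using cnj_csqrt[OF assms] by (simp add: laguerre_iter_def)

text \<open>
  A nonzero point of the nonpositive real axis has direction \<open>-1\<close>, so \<open>n * Arg z\<close> is an odd multiple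
  \<open>(2 * m + 1) * pi\<close> of \<open>pi\<close>. Here \<open>m\<close> is an arbitrary integer; changing it by a multiple of \<open>n\<close>
  changes \<open>Arg z\<close> by a multiple of \<open>2 * pi\<close>, so \<open>m\<close> can be replaced by its remainder modulo \<open>n\<close>.
\<close>

lemma Arg_rcong_odd_pi_over_n_if_power_nonpos:
  assumes "n > 0" and "z \<noteq> 0" and "z ^ n \<in> \<real>\<^sub>\<le>\<^sub>0"
  shows "\<exists>k<n. [Arg z = (2 * real k + 1) * pi / real n] (rmod (2 * pi))"
proof -
  have "z ^ n = rcis (cmod z ^ n) (real n * Arg z)"
    by (metis DeMoivre2 rcis_cmod_Arg)
  then have "Im (z ^ n) = cmod z ^ n * sin (real n * Arg z)"
    and "Re (z ^ n) = cmod z ^ n * cos (real n * Arg z)"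
    by simp_all
  moreover have "Im (z ^ n) = 0" and "Re (z ^ n) \<le> 0"
    using assms(3) by (auto simp: complex_nonpos_Reals_iff)
  moreover have "cmod z ^ n > 0"
    using assms(2) by simp
  ultimately have "sin (real n * Arg z) = 0" and "cos (real n * Arg z) \<le> 0"
    using assms(2) by (auto simp: mult_le_0_iff)
  then have "cos (real n * Arg z) = -1"
    using sin_cos_squared_add[of "real n * Arg z"] by (simp add: power2_eq_1_iff)
  then obtain m :: int where m: "real n * Arg z = (2 * real_of_int m + 1) * pi"
    by (auto simp: cos_eq_minus1)
  define k where "k = nat (m mod int n)"
  have "k < n" and k: "int k = m mod int n"
    using assms(1) by (simp_all add: k_def nat_less_iff)
  have "m = int n * (m div int n) + int k"
    by (simp add: k)
  then have "real_of_int m = real n * real_of_int (m div int n) + real k"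
    by (metis of_int_add of_int_mult of_int_of_nat_eq)
  with m have "(2 * real k + 1) * pi / real n
      = Arg z + real_of_int (- (m div int n)) * (2 * pi)"
    using assms(1) by (simp add: field_simps)
  then show ?thesis
    using \<open>k < n\<close> unfolding rcong_altdef by blast
qed

theorem proposition3p2:
  fixes n :: nat and z :: complex
  assumes "n \<ge> 2"
    and "z \<noteq> 0"
    and "\<forall>k<n. \<not> [Arg z = (2 * real k + 1) * pi / real n] (rmod (2 * pi))"
  shows "laguerre_iter n (cnj z) = cnj (laguerre_iter n z)"
proof (rule laguerre_iter_cnj)
  show "z ^ n \<notin> \<real>\<^sub>\<le>\<^sub>0"
    using Arg_rcong_odd_pi_over_n_if_power_nonpos[of n z] assms by auto
qed

end
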